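(* The Lie algebroid associated to the Lie groupoid $\mathcal{G}\Rightarrow\mathbb{O}^2$ described in the context is given by the following data: (1) the trivial vector bundle $E_0=\underline{\mathbb{O}^2}$ over $\mathbb{O}^2$ with fiber $\mathbb{O}^2$; (2) the anchor map $\rho:E_0\to T\mathbb{O}^2\cong\underline{\mathbb{O}^2}$, $$\rho\begin{pmatrix}u \\ v\end{pmatrix}=\begin{pmatrix}\|x\|^2u+(x\cdot\overline{y})\cdot v-(\langle x,u\rangle+\langle y,v\rangle)x \\ \|y\|^2v+(y\cdot\overline{x})\cdot u-(\langle x,u\rangle+\langle y,v\rangle)y\end{pmatrix}$$ for every $\begin{pmatrix}u \\ v\end{pmatrix}\in E_0$ based at $(x,y)\in\mathbb{O}^2$; (3) the Lie bracket which, evaluated on constant sections $\begin{pmatrix}u \\ v\end{pmatrix},\begin{pmatrix}u' \\ v'\end{pmatrix}\in\Gamma(E_0)$, is $$\left[\begin{pmatrix}u \\ v\end{pmatrix},\begin{pmatrix}u' \\ v'\end{pmatrix}\right]=(\langle x,u\rangle+\langle y,v\rangle)\begin{pmatrix}u' \\ v'\end{pmatrix}-(\langle x,u'\rangle+\langle y,v'\rangle)\begin{pmatrix}u \\ v\end{pmatrix}.$$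
   Context: $\mathbb{O}\cong\mathbb{R}^8$ denotes the octonions: the real unital non-associative algebra with orthonormal basis $e_0=1,e_1,\dots,e_7$ and $e_i\cdot e_j=-\delta_{ij}1+\sum_k\epsilon_{ijk}e_k$ for $1\le i,j\le 7$, where $\epsilon_{ijk}$ is completely antisymmetric, equal to $1$ for $ijk\in\{123,145,176,246,257,347,365\}$, and $0$ for all triples that are not permutations of these; $\langle\cdot,\cdot\rangle$, $\|\cdot\|$ are the Euclidean inner product and norm and $\overline{a}=2\langle a,1\rangle 1-a$ is conjugation. Lie groupoid $\mathcal{G}\Rightarrow\mathbb{O}^2$: with $\lambda(F,G,x,y)=\sqrt{1+2(\langle x,F\rangle+\langle y,G\rangle+\langle x\cdot\overline{y},F\cdot\overline{G}\rangle)+\|x\|^2\|F\|^2+\|y\|^2\|G\|^2}$, the arrow manifold is $\mathcal{G}=\{(F,G,x,y)\in\mathbb{O}^2\times\mathbb{O}^2:\lambda\neq0\}$; for $g=(F,G,x,y)$: $\mathrm{s}(g)=(x,y)$, $\mathrm{t}(g)=\frac{1}{\lambda(g)}(x+\|x\|^2F+(x\cdot\overline{y})\cdot G,\ y+\|y\|^2G+(y\cdot\overline{x})\cdot F)$; for $g'=(F',G',x',y')$ with $\mathrm{s}(g')=\mathrm{t}(g)$: $g'\cdot g=(F+\lambda(g)F',G+\lambda(g)G',x,y)$; units $\mathrm{u}(x,y)=(0,0,x,y)$; inverse $g^{-1}=(-F/\lambda(g),-G/\lambda(g),\mathrm{t}(g))$. Convention: the Lie algebroid of a Lie groupoid is the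 bundle $\ker\mathrm{d}\mathrm{s}$ restricted to the units, with anchor $\mathrm{d}\mathrm{t}$ and bracket induced by the Lie bracket of right-invariant vector fields on $\mathcal{G}$. Here $\ker\mathrm{d}\mathrm{s}|_{\mathrm{u}(\mathbb{O}^2)}$ is identified with $\underline{\mathbb{O}^2}$ by $\begin{pmatrix}u \\ v\end{pmatrix}\leftrightarrow\sum_{i=0}^7\left(u^i\frac{\partial}{\partial F^i}+v^i\frac{\partial}{\partial G^i}\right)$, where $F^i,G^i$ are the components of $F,G$ in the basis $e_i$. The bracket on general sections is determined by the Leibniz rule. *)

theory Defs
  imports "HOL-Analysis.Analysis"
begin

section \<open>Octonions\<close>

text \<open>
  The octonions are the Euclidean space \<open>real^8\<close>; the coordinates are indexed by the elements
  \<open>0, \<dots>, 7\<close> of the numeral type \<open>8\<close>.  The library's own \<open>*\<close> and \<open>1\<close> on \<open>real^8\<close> are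
  componentwise and are not the octonion product and unit.
\<close>

type_synonym octonion = "real^8"

definition oct_e :: "8 \<Rightarrow> octonion" where
  "oct_e i = axis i 1"

definition oct_triples :: "(8 \<times> 8 \<times> 8) set" where
  "oct_triples = {(1,2,3), (1,4,5), (1,7,6), (2,4,6), (2,5,7), (3,4,7), (3,6,5)}"

definition oct_even :: "8 \<Rightarrow> 8 \<Rightarrow> 8 \<Rightarrow> bool" where
  "oct_even i j k \<longleftrightarrow>
     (i,j,k) \<in> oct_triples \<or> (j,k,i) \<in> oct_triples \<or> (k,i,j) \<in> oct_triples"

text \<open>
  The completely antisymmetric symbol: 1 on the cyclic (that is, even) permutations of the seven
  triples, -1 on the odd ones, and 0 elsewhere.
\<close>

definition oct_eps :: "8 \<Rightarrow> 8 \<Rightarrow> 8 \<Rightarrow> real" where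
  "oct_eps i j k = (if oct_even i j k then 1 else if oct_even j i k then -1 else 0)"

definition oct_basis_mult :: "8 \<Rightarrow> 8 \<Rightarrow> octonion" where
  "oct_basis_mult i j =
     (if i = 0 then oct_e j
      else if j = 0 then oct_e i
      else (if i = j then - oct_e 0 else 0) + (\<Sum>k\<in>UNIV. oct_eps i j k *\<^sub>R oct_e k))"

definition oct_mult :: "octonion \<Rightarrow> octonion \<Rightarrow> octonion"  (infixl "\<odot>" 70) where
  "a \<odot> b = (\<Sum>i\<in>UNIV. \<Sum>j\<in>UNIV. (a $ i * b $ j) *\<^sub>R oct_basis_mult i j)"

definition oct_cnj :: "octonion \<Rightarrow> octonion" where
  "oct_cnj a = (2 * (a \<bullet> oct_e 0)) *\<^sub>R oct_e 0 - a"

section \<open>Smooth maps and vector fields on open subsets of Euclidean spaces\<close>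

primrec Ck_on ::
  "nat \<Rightarrow> ('a::euclidean_space \<Rightarrow> 'b::euclidean_space) \<Rightarrow> 'a set \<Rightarrow> bool" where
  "Ck_on 0 f S \<longleftrightarrow> continuous_on S f"
| "Ck_on (Suc k) f S \<longleftrightarrow>
     (\<forall>p\<in>S. f differentiable (at p)) \<and> (\<forall>v. Ck_on k (\<lambda>p. frechet_derivative f (at p) v) S)"

definition smooth_on :: "'a::euclidean_space set \<Rightarrow> ('a \<Rightarrow> 'b::euclidean_space) \<Rightarrow> bool" where
  "smooth_on S f \<longleftrightarrow> (\<forall>k. Ck_on k f S)"

text \<open>
  The sign is that of the commutator of derivations:
  \<open>[X, Y](\<phi>) = X(Y(\<phi>)) - Y(X(\<phi>))\<close>.
\<close>

definition vector_field_bracket :: "('a::euclidean_space \<Rightarrow> 'a) \<Rightarrow> ('a \<Rightarrow> 'a) \<Rightarrow> 'a \<Rightarrow> 'a" where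
  "vector_field_bracket X Y p =
     frechet_derivative Y (at p) (X p) - frechet_derivative X (at p) (Y p)"

section \<open>The Lie algebroid of a Lie groupoid\<close>

text \<open>
  Structure maps of a groupoid whose manifolds of arrows and of objects are open subsets of
  Euclidean spaces, so that all their tangent spaces are the ambient spaces \<open>'g\<close> and \<open>'m\<close>.
  \<open>gmult h g\<close> is the product \<open>h \<cdot> g\<close>, meaningful if \<open>source h = target g\<close>.
\<close>

record ('g, 'm) groupoid_maps =
  arrows :: "'g set"
  objects :: "'m set"
  source :: "'g \<Rightarrow> 'm"
  target :: "'g \<Rightarrow> 'm"
  gmult :: "'g \<Rightarrow> 'g \<Rightarrow> 'g"
  gunit :: "'m \<Rightarrow> 'g"
  ginv :: "'g \<Rightarrow> 'g"

definition algebroid_fibre ::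
  "('g::euclidean_space, 'm::euclidean_space) groupoid_maps \<Rightarrow> 'm \<Rightarrow> 'g set" where
  "algebroid_fibre \<G> m = {\<xi>. frechet_derivative (source \<G>) (at (gunit \<G> m)) \<xi> = 0}"

definition algebroid_anchor ::
  "('g::euclidean_space, 'm::euclidean_space) groupoid_maps \<Rightarrow> 'm \<Rightarrow> 'g \<Rightarrow> 'm" where
  "algebroid_anchor \<G> m \<xi> = frechet_derivative (target \<G>) (at (gunit \<G> m)) \<xi>"

definition algebroid_section ::
  "('g::euclidean_space, 'm::euclidean_space) groupoid_maps \<Rightarrow> ('m \<Rightarrow> 'g) \<Rightarrow> bool" where
  "algebroid_section \<G> \<sigma> \<longleftrightarrow>
     smooth_on (objects \<G>) \<sigma> \<and> (\<forall>m\<in>objects \<G>. \<sigma> m \<in> algebroid_fibre \<G> m)"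

text \<open>
  The right-invariant vector field extending a section \<open>\<sigma>\<close>: its value at \<open>g\<close> is the image of
  \<open>\<sigma> (target g)\<close> under the differential, at the unit of \<open>target g\<close>, of the right translation
  \<open>h \<mapsto> h \<cdot> g\<close>, which is defined on the source fibre over \<open>target g\<close> only.  A derivative
  within this submanifold is unique just on its tangent vectors, that is, on the kernel of the
  differential of the source map; \<open>\<sigma> (target g)\<close> lies there.
\<close>

definition right_invariant_field ::
  "('g::euclidean_space, 'm::euclidean_space) groupoid_maps \<Rightarrow> ('m \<Rightarrow> 'g) \<Rightarrow> 'g \<Rightarrow> 'g" where
  "right_invariant_field \<G> \<sigma> g =
     frechet_derivative (\<lambda>h. gmult \<G> h g)
       (at (gunit \<G> (target \<G> g)) within {h \<in> arrows \<G>. source \<G> h = target \<G> g})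
       (\<sigma> (target \<G> g))"

definition algebroid_bracket ::
  "('g::euclidean_space, 'm::euclidean_space) groupoid_maps
     \<Rightarrow> ('m \<Rightarrow> 'g) \<Rightarrow> ('m \<Rightarrow> 'g) \<Rightarrow> 'm \<Rightarrow> 'g" where
  "algebroid_bracket \<G> \<sigma> \<tau> m =
     vector_field_bracket (right_invariant_field \<G> \<sigma>) (right_invariant_field \<G> \<tau>) (gunit \<G> m)"

section \<open>The groupoid over pairs of octonions\<close>

type_synonym oct_arrow = "octonion \<times> octonion \<times> octonion \<times> octonion"

fun oct_lambda :: "oct_arrow \<Rightarrow> real" where
  "oct_lambda (F, G, x, y) =
     sqrt (1 + 2 * (x \<bullet> F + y \<bullet> G + (x \<odot> oct_cnj y) \<bullet> (F \<odot> oct_cnj G))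
           + (norm x)\<^sup>2 * (norm F)\<^sup>2 + (norm y)\<^sup>2 * (norm G)\<^sup>2)"

fun oct_source :: "oct_arrow \<Rightarrow> octonion \<times> octonion" where
  "oct_source (F, G, x, y) = (x, y)"

fun oct_target :: "oct_arrow \<Rightarrow> octonion \<times> octonion" where
  "oct_target (F, G, x, y) =
     (1 / oct_lambda (F, G, x, y)) *\<^sub>R
       (x + (norm x)\<^sup>2 *\<^sub>R F + (x \<odot> oct_cnj y) \<odot> G,
        y + (norm y)\<^sup>2 *\<^sub>R G + (y \<odot> oct_cnj x) \<odot> F)"

fun oct_gmult :: "oct_arrow \<Rightarrow> oct_arrow \<Rightarrow> oct_arrow" where
  "oct_gmult (F', G', x', y') (F, G, x, y) =
     (F + oct_lambda (F, G, x, y) *\<^sub>R F', G + oct_lambda (F, G, x, y) *\<^sub>R G', x, y)"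

fun oct_gunit :: "octonion \<times> octonion \<Rightarrow> oct_arrow" where
  "oct_gunit (x, y) = (0, 0, x, y)"

fun oct_ginv :: "oct_arrow \<Rightarrow> oct_arrow" where
  "oct_ginv (F, G, x, y) =
     (- (1 / oct_lambda (F, G, x, y)) *\<^sub>R F, - (1 / oct_lambda (F, G, x, y)) *\<^sub>R G,
      oct_target (F, G, x, y))"

definition oct_groupoid :: "(oct_arrow, octonion \<times> octonion) groupoid_maps" where
  "oct_groupoid =
     \<lparr>arrows = {g. oct_lambda g \<noteq> 0}, objects = UNIV,
      source = oct_source, target = oct_target,
      gmult = oct_gmult, gunit = oct_gunit, ginv = oct_ginv\<rparr>"

text \<open>
  The identification of a fibre of the trivial bundle with the kernel of the differential of the
  source map: \<open>(u, v)\<close> goes to the tangent vector with components \<open>u\<close> along \<open>F\<close> and \<open>v\<close> along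
  \<open>G\<close>.  It is the same map over every base point.
\<close>

fun E0_incl :: "octonion \<times> octonion \<Rightarrow> oct_arrow" where
  "E0_incl (u, v) = (u, v, 0, 0)"

end

theory Submission
  imports Defs
begin

text \<open>
  A right-invariant vector field is \<open>g \<mapsto> \<lambda>(g) \<sigma>(t(g))\<close>, because right translation by \<open>g\<close> is
  affine with linear part \<open>\<lambda>(g)\<close> on the source fibres.  Hence only the differentials of \<open>\<lambda>\<close> and
  \<open>t\<close> at the units are needed.  There the terms of \<open>\<lambda>\<^sup>2\<close> that are quadratic in \<open>(F, G)\<close> do not
  contribute, so that neither alternativity nor the norm identity of the octonions plays a role.
\<close>

section \<open>Bilinearity of the product and linearity of conjugation\<close>

lemma bounded_bilinear_oct_mult: "bounded_bilinear oct_mult"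
proof -
  have "bilinear oct_mult"
    unfolding bilinear_def oct_mult_def
    by (intro conjI allI linearI)
      (simp_all add: distrib_left distrib_right scaleR_add_left sum.distrib scaleR_sum_right
        mult.assoc mult.left_commute)
  \<comment> \<open>In finite dimension a bilinear map is bounded; the product rule
    \<open>oct_mult.FDERIV\<close> rests on this.\<close>
  then show ?thesis
    by (simp add: bilinear_conv_bounded_bilinear)
qed

interpretation oct_mult: bounded_bilinear oct_mult
  by (rule bounded_bilinear_oct_mult)

lemma bounded_linear_oct_cnj: "bounded_linear oct_cnj"
  unfolding oct_cnj_def
  by (intro linear_conv_bounded_linear[THEN iffD1] linearI)
    (auto simp: algebra_simps)

lemma oct_cnj_zero: "oct_cnj 0 = 0"
  by (simp add: oct_cnj_def)

section \<open>Differentiability of smooth maps and derivatives within a set\<close>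

lemma Ck_on_Suc_differentiable: "Ck_on (Suc k) f S \<Longrightarrow> p \<in> S \<Longrightarrow> f differentiable (at p)"
  by simp

lemma smooth_on_differentiable: "smooth_on S f \<Longrightarrow> p \<in> S \<Longrightarrow> f differentiable (at p)"
  unfolding smooth_on_def by (rule Ck_on_Suc_differentiable[of 0]) auto

text \<open>Along the line through \<open>p\<close> with direction \<open>\<xi>\<close> the chain
  rule turns both derivatives into derivatives of one curve at an interior point of the real line,
  where they are unique. This handles source fibres, which have empty interior, so that a derivative
  within them is determined on tangent vectors only.\<close>

lemma has_derivative_within_unique_direction:
  fixes f :: "'a::real_normed_vector \<Rightarrow> 'b::real_normed_vector"
  assumes D: "(f has_derivative D) (at p within S)"
    and D': "(f has_derivative D') (at p within S)"
    and ev: "\<forall>\<^sub>F t in nhds (0::real). p + t *\<^sub>R \<xi> \<in> S"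
  shows "D \<xi> = D' \<xi>"
proof -
  obtain T where T: "open T" "0 \<in> T" and TS: "\<And>t. t \<in> T \<Longrightarrow> p + t *\<^sub>R \<xi> \<in> S"
    using ev by (auto simp: eventually_nhds)
  have line: "((\<lambda>t. p + t *\<^sub>R \<xi>) has_derivative (\<lambda>t. t *\<^sub>R \<xi>)) (at 0 within T)"
    by (auto intro!: derivative_eq_intros)
  have *: "((\<lambda>t. f (p + t *\<^sub>R \<xi>)) has_derivative (\<lambda>t. E (t *\<^sub>R \<xi>))) (at 0)"
    if "(f has_derivative E) (at p within S)" for E
  proof -
    have "(\<lambda>t. p + t *\<^sub>R \<xi>) ` T \<subseteq> S"
      by (rule image_subsetI) (rule TS)
    from has_derivative_subset[OF that this]
    have "(f has_derivative E) (at (p + 0 *\<^sub>R \<xi>) within (\<lambda>t. p + t *\<^sub>R \<xi>) ` T)"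
      unfolding scaleR_zero_left add_0_right .
    \<comment> \<open>\<open>T\<close> is open and contains 0, so the derivative within
      \<open>T\<close> is an unrestricted one.\<close>
    from has_derivative_in_compose[OF line this] show ?thesis
      unfolding at_within_open[OF T(2,1)] .
  qed
  have "(\<lambda>t. D (t *\<^sub>R \<xi>)) = (\<lambda>t. D' (t *\<^sub>R \<xi>))"
    by (rule has_derivative_unique[OF *[OF D] *[OF D']])
  from fun_cong[OF this, of 1] show ?thesis by simp
qed

section \<open>Structure maps in terms of coordinate projections\<close>

lemma E0_incl_eq: "E0_incl w = (fst w, snd w, 0)"
  by (cases w) (simp add: zero_prod_def)

lemma range_E0_incl: "range E0_incl = {\<xi>. snd (snd \<xi>) = 0}"
  by (auto simp: E0_incl_eq image_iff prod_eq_iff)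

lemma oct_source_eq: "oct_source = (\<lambda>g. snd (snd g))"
  by (auto simp: fun_eq_iff)

text \<open>Projections replace pattern matching so that the derivative rules apply, and squared
  norms become inner products, since the norm itself is not differentiable at 0.\<close>

lemma oct_lambda_eq:
  "oct_lambda = (\<lambda>g. sqrt (1 + 2 * (fst (snd (snd g)) \<bullet> fst g + snd (snd (snd g)) \<bullet> fst (snd g)
     + (fst (snd (snd g)) \<odot> oct_cnj (snd (snd (snd g)))) \<bullet> (fst g \<odot> oct_cnj (fst (snd g))))
     + (fst (snd (snd g)) \<bullet> fst (snd (snd g))) * (fst g \<bullet> fst g)
     + (snd (snd (snd g)) \<bullet> snd (snd (snd g))) * (fst (snd g) \<bullet> fst (snd g))))"
  by (auto simp: fun_eq_iff power2_norm_eq_inner)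

lemma oct_target_eq:
  "oct_target = (\<lambda>g. inverse (oct_lambda g) *\<^sub>R
     (fst (snd (snd g)) + (fst (snd (snd g)) \<bullet> fst (snd (snd g))) *\<^sub>R fst g
        + (fst (snd (snd g)) \<odot> oct_cnj (snd (snd (snd g)))) \<odot> fst (snd g),
      snd (snd (snd g)) + (snd (snd (snd g)) \<bullet> snd (snd (snd g))) *\<^sub>R fst (snd g)
        + (snd (snd (snd g)) \<odot> oct_cnj (fst (snd (snd g)))) \<odot> fst g))"
  by (auto simp: fun_eq_iff power2_norm_eq_inner inverse_eq_divide)

lemma oct_gunit_eq: "oct_gunit p = (0, 0, p)"
  by (cases p) simp

lemma oct_gmult_eq:
  "oct_gmult h g = (fst g + oct_lambda g *\<^sub>R fst h,
     fst (snd g) + oct_lambda g *\<^sub>R fst (snd h), snd (snd g))"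
  by (cases h; cases g) auto

lemma oct_lambda_gunit [simp]: "oct_lambda (0, 0, p) = 1"
  by (simp add: oct_lambda_eq oct_mult.zero_left)

lemma oct_target_gunit [simp]: "oct_target (0, 0, p) = p"
  by (simp add: oct_target_eq oct_mult.zero_right)

section \<open>Differentials of \<open>oct_lambda\<close> and \<open>oct_target\<close> at the
  units\<close>

definition oct_dlambda :: "octonion \<times> octonion \<Rightarrow> oct_arrow \<Rightarrow> real" where
  "oct_dlambda p \<xi> = fst p \<bullet> fst \<xi> + snd p \<bullet> fst (snd \<xi>)"

text \<open>The last summand is the contribution of the factor \<open>1 / oct_lambda\<close>; the
  other two differentiate the pair that it multiplies.\<close>

definition oct_dtarget :: "octonion \<times> octonion \<Rightarrow> oct_arrow \<Rightarrow> octonion \<times> octonion" where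
  "oct_dtarget p \<xi> = snd (snd \<xi>) +
     ((fst p \<bullet> fst p) *\<^sub>R fst \<xi> + (fst p \<odot> oct_cnj (snd p)) \<odot> fst (snd \<xi>),
      (snd p \<bullet> snd p) *\<^sub>R fst (snd \<xi>) + (snd p \<odot> oct_cnj (fst p)) \<odot> fst \<xi>)
     - oct_dlambda p \<xi> *\<^sub>R p"

text \<open>The four entries belong to the coordinates F, G, x, y in this order;
  \<open>coord_cnj_derivs\<close> keeps the numbering.\<close>

lemmas coord_derivs =
  has_derivative_fst[OF has_derivative_ident]
  has_derivative_fst[OF has_derivative_snd[OF has_derivative_ident]]
  has_derivative_fst[OF has_derivative_snd[OF has_derivative_snd[OF has_derivative_ident]]]
  has_derivative_snd[OF has_derivative_snd[OF has_derivative_snd[OF has_derivative_ident]]]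

lemmas coord_cnj_derivs =
  coord_derivs[THEN bounded_linear.has_derivative[OF bounded_linear_oct_cnj]]

lemma oct_lambda_has_derivative:
  "(oct_lambda has_derivative oct_dlambda p) (at (0, 0, p))"
proof -
  \<comment> \<open>Both F and the conjugate of G vanish at a unit, so every term of the product
    rule keeps a zero factor.\<close>
  have K: "((\<lambda>g. (fst (snd (snd g)) \<odot> oct_cnj (snd (snd (snd g)))) \<bullet> (fst g \<odot> oct_cnj (fst (snd g))))
      has_derivative (\<lambda>_. 0)) (at (0, 0, p))"
    by (rule has_derivative_eq_rhs[OF has_derivative_inner[OF
          oct_mult.FDERIV[OF coord_derivs(3) coord_cnj_derivs(4)]
          oct_mult.FDERIV[OF coord_derivs(1) coord_cnj_derivs(2)]]])
      (simp add: oct_cnj_zero oct_mult.zero_left oct_mult.zero_right)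
  show ?thesis
    unfolding oct_lambda_eq
    \<comment> \<open>The radicand is 1 at a unit, so the 1/2 from the square root cancels the
      factor 2. The terms with squared norms of F and G have derivative zero there.\<close>
    by (rule has_derivative_eq_rhs, rule has_derivative_real_sqrt[rotated],
        (rule derivative_intros K coord_derivs)+)
      (auto simp: fun_eq_iff oct_dlambda_def oct_mult.zero_left inner_commute)
qed

lemma oct_target_has_derivative:
  "(oct_target has_derivative oct_dtarget p) (at (0, 0, p))"
proof -
  have inv: "((\<lambda>g. inverse (oct_lambda g)) has_derivative (\<lambda>\<xi>. - oct_dlambda p \<xi>)) (at (0, 0, p))"
    by (rule has_derivative_eq_rhs[OF Deriv.has_derivative_inverse[OF _ oct_lambda_has_derivative]]) auto
  \<comment> \<open>In these triple products the last factor is G or F, which is 0 at a unit; only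
    the term that differentiates this factor survives.\<close>
  note products =
    oct_mult.FDERIV[OF oct_mult.FDERIV[OF coord_derivs(3) coord_cnj_derivs(4)] coord_derivs(2)]
    oct_mult.FDERIV[OF oct_mult.FDERIV[OF coord_derivs(4) coord_cnj_derivs(3)] coord_derivs(1)]
  show ?thesis
    unfolding oct_target_eq
    by (rule has_derivative_eq_rhs, rule has_derivative_scaleR[OF inv],
        (rule has_derivative_Pair has_derivative_add has_derivative_scaleR
          has_derivative_inner products coord_derivs)+)
      (auto simp: fun_eq_iff oct_dtarget_def oct_mult.zero_right prod_eq_iff)
qed

section \<open>Fibres, anchor and right-invariant fields\<close>

lemma algebroid_fibre_oct_groupoid: "algebroid_fibre oct_groupoid p = range E0_incl"
proof -
  have "(oct_source has_derivative (\<lambda>\<xi>. snd (snd \<xi>))) (at (oct_gunit p))"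
    unfolding oct_source_eq by (auto intro!: derivative_eq_intros)
  from frechet_derivative_at[OF this, symmetric] show ?thesis
    unfolding algebroid_fibre_def range_E0_incl by (simp add: oct_groupoid_def)
qed

lemma algebroid_anchor_oct_groupoid: "algebroid_anchor oct_groupoid p = oct_dtarget p"
  using frechet_derivative_at[OF oct_target_has_derivative[of p]]
  unfolding algebroid_anchor_def by (simp add: oct_groupoid_def oct_gunit_eq fun_eq_iff)

lemma right_invariant_field_oct_groupoid:
  assumes "\<sigma> (oct_target g) \<in> range E0_incl"
  shows "right_invariant_field oct_groupoid \<sigma> g = oct_lambda g *\<^sub>R \<sigma> (oct_target g)"
proof -
  define q where "q = oct_target g"
  define S where "S = {h. oct_lambda h \<noteq> 0 \<and> oct_source h = q}"
  let ?R = "\<lambda>h. oct_gmult h g"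
  let ?D = "\<lambda>\<xi>. (oct_lambda g *\<^sub>R fst \<xi>, oct_lambda g *\<^sub>R fst (snd \<xi>), 0)"
  from assms have vert: "snd (snd (\<sigma> q)) = 0"
    unfolding range_E0_incl q_def by simp
  have D: "(?R has_derivative ?D) (at (0, 0, q) within S)"
    unfolding oct_gmult_eq by (auto intro!: derivative_eq_intros)
  \<comment> \<open>\<open>frechet_derivative\<close> picks some derivative within \<open>S\<close>,
    which may differ from \<open>?D\<close> off the tangent space; only its value at
    \<open>\<sigma> q\<close> is forced.\<close>
  then have "?R differentiable (at (0, 0, q) within S)"
    by (rule differentiableI)
  then have D': "(?R has_derivative frechet_derivative ?R (at (0, 0, q) within S))
      (at (0, 0, q) within S)"
    by (simp add: frechet_derivative_works)
  \<comment> \<open>As \<open>\<sigma> q\<close> is vertical, the line through the unit keeps its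
    source \<open>q\<close>; continuity of \<open>oct_lambda\<close>, which is 1 at the unit, keeps
    it among the arrows for small \<open>t\<close>.\<close>
  have "isCont oct_lambda (0, 0, q)"
    using oct_lambda_has_derivative has_derivative_continuous by blast
  moreover have "((\<lambda>t. (0, 0, q) + t *\<^sub>R \<sigma> q) \<longlongrightarrow> (0, 0, q)) (nhds (0::real))"
    by (auto intro!: tendsto_eq_intros filterlim_ident)
  ultimately have "((\<lambda>t. oct_lambda ((0, 0, q) + t *\<^sub>R \<sigma> q)) \<longlongrightarrow> 1) (nhds (0::real))"
    using isCont_tendsto_compose by fastforce
  then have "\<forall>\<^sub>F t in nhds (0::real). oct_lambda ((0, 0, q) + t *\<^sub>R \<sigma> q) \<noteq> 0"
    by (rule tendsto_imp_eventually_ne) simp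
  then have "\<forall>\<^sub>F t in nhds (0::real). (0, 0, q) + t *\<^sub>R \<sigma> q \<in> S"
    by eventually_elim (simp add: S_def oct_source_eq vert)
  from has_derivative_within_unique_direction[OF D' D this]
  show ?thesis
    unfolding right_invariant_field_def
    by (simp add: oct_groupoid_def oct_gunit_eq S_def q_def[symmetric] prod_eq_iff vert)
qed

section \<open>The bracket of two sections\<close>

lemma algebroid_bracket_oct_groupoid:
  assumes \<sigma>: "range \<sigma> \<subseteq> range E0_incl" "(\<sigma> has_derivative \<sigma>') (at p)"
    and \<tau>: "range \<tau> \<subseteq> range E0_incl" "(\<tau> has_derivative \<tau>') (at p)"
  shows "algebroid_bracket oct_groupoid \<sigma> \<tau> p =
    oct_dlambda p (\<sigma> p) *\<^sub>R \<tau> p + \<tau>' (oct_dtarget p (\<sigma> p))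
    - (oct_dlambda p (\<tau> p) *\<^sub>R \<sigma> p + \<sigma>' (oct_dtarget p (\<tau> p)))"
proof -
  \<comment> \<open>The formula holds on the whole ambient space, so it can be substituted as an
    equality of functions under \<open>frechet_derivative\<close>.\<close>
  have field: "right_invariant_field oct_groupoid \<phi> = (\<lambda>g. oct_lambda g *\<^sub>R \<phi> (oct_target g))"
    if "range \<phi> \<subseteq> range E0_incl" for \<phi>
    using that by (intro ext right_invariant_field_oct_groupoid) blast
  have deriv: "frechet_derivative (\<lambda>g. oct_lambda g *\<^sub>R \<phi> (oct_target g)) (at (0, 0, p)) =
      (\<lambda>\<xi>. oct_dlambda p \<xi> *\<^sub>R \<phi> p + \<phi>' (oct_dtarget p \<xi>))"
    if "(\<phi> has_derivative \<phi>') (at p)" for \<phi> \<phi>' :: "octonion \<times> octonion \<Rightarrow> oct_arrow"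
  proof -
    \<comment> \<open>At the unit over \<open>p\<close> the target is \<open>p\<close> and
      \<open>oct_lambda\<close> is 1; hence \<open>\<phi>\<close> is differentiated at
      \<open>p\<close> and its derivative carries no further factor.\<close>
    have "((\<lambda>g. \<phi> (oct_target g)) has_derivative (\<lambda>\<xi>. \<phi>' (oct_dtarget p \<xi>))) (at (0, 0, p))"
      using has_derivative_compose[OF oct_target_has_derivative, of \<phi> \<phi>' p] that by simp
    from has_derivative_scaleR[OF oct_lambda_has_derivative this]
    have "((\<lambda>g. oct_lambda g *\<^sub>R \<phi> (oct_target g)) has_derivative
        (\<lambda>\<xi>. oct_dlambda p \<xi> *\<^sub>R \<phi> p + \<phi>' (oct_dtarget p \<xi>))) (at (0, 0, p))"
      by (simp add: add.commute)
    from frechet_derivative_at[OF this] show ?thesis by simp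
  qed
  show ?thesis
    unfolding algebroid_bracket_def vector_field_bracket_def field[OF \<sigma>(1)] field[OF \<tau>(1)]
    by (simp add: oct_groupoid_def oct_gunit_eq deriv[OF \<sigma>(2)] deriv[OF \<tau>(2)])
qed

section \<open>Closure, skew-symmetry, additivity and the Leibniz rule\<close>

lemma algebroid_section_oct_groupoidD:
  assumes "algebroid_section oct_groupoid \<sigma>"
  shows "range \<sigma> \<subseteq> range E0_incl"
    and "(\<sigma> has_derivative frechet_derivative \<sigma> (at p)) (at p)"
proof -
  from assms have smooth: "smooth_on UNIV \<sigma>" and fibre: "\<forall>m. \<sigma> m \<in> range E0_incl"
    unfolding algebroid_section_def algebroid_fibre_oct_groupoid
    by (simp_all add: oct_groupoid_def)
  from fibre show "range \<sigma> \<subseteq> range E0_incl" by blast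
  from smooth_on_differentiable[OF smooth, of p]
  show "(\<sigma> has_derivative frechet_derivative \<sigma> (at p)) (at p)"
    by (simp add: frechet_derivative_works)
qed

text \<open>The composite of \<open>L\<close> and \<open>f\<close> is constantly 0, and derivatives
  are unique.\<close>

lemma has_derivative_in_kernel:
  assumes L: "bounded_linear L" and f: "(f has_derivative f') (at p)" and "\<And>q. L (f q) = 0"
  shows "L (f' v) = 0"
proof -
  have "((\<lambda>q. L (f q)) has_derivative (\<lambda>v. L (f' v))) (at p)"
    by (rule bounded_linear.has_derivative[OF L f])
  then have "(\<lambda>v. L (f' v)) = (\<lambda>_. 0)"
    using assms(3) by (intro has_derivative_unique[where f = "\<lambda>_. 0"]) auto
  then show ?thesis by (rule fun_cong)
qed

lemma subspace_range_E0_incl: "subspace (range E0_incl)"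
  unfolding range_E0_incl by (auto simp: subspace_def)

text \<open>The bracket contains derivatives of sections; these stay vertical because the fibre is
  the kernel of a fixed linear projection.\<close>

lemma has_derivative_range_E0_incl:
  assumes "(\<sigma> has_derivative \<sigma>') (at p)" "range \<sigma> \<subseteq> range E0_incl"
  shows "\<sigma>' v \<in> range E0_incl"
proof -
  have "bounded_linear (\<lambda>\<xi>::oct_arrow. snd (snd \<xi>))"
    by (intro bounded_linear_intros)
  moreover have "snd (snd (\<sigma> q)) = 0" for q
    using assms(2) unfolding range_E0_incl by blast
  ultimately have "snd (snd (\<sigma>' v)) = 0"
    using has_derivative_in_kernel[OF _ assms(1)] by blast
  then show ?thesis
    unfolding range_E0_incl by simp
qed

lemma algebroid_bracket_in_fibre:
  assumes \<sigma>: "algebroid_section oct_groupoid \<sigma>" and \<tau>: "algebroid_section oct_groupoid \<tau>"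
  shows "algebroid_bracket oct_groupoid \<sigma> \<tau> p \<in> algebroid_fibre oct_groupoid p"
proof -
  note \<sigma>D = algebroid_section_oct_groupoidD[OF \<sigma>] and \<tau>D = algebroid_section_oct_groupoidD[OF \<tau>]
  show ?thesis
    unfolding algebroid_fibre_oct_groupoid algebroid_bracket_oct_groupoid[OF \<sigma>D \<tau>D]
    using \<sigma>D(1) \<tau>D(1) has_derivative_range_E0_incl[OF \<sigma>D(2,1)]
      has_derivative_range_E0_incl[OF \<tau>D(2,1)]
    by (intro subspace_diff subspace_add subspace_scale subspace_range_E0_incl) auto
qed

lemma algebroid_bracket_skew:
  "algebroid_bracket \<G> \<sigma> \<tau> p = - algebroid_bracket \<G> \<tau> \<sigma> p"
  by (simp add: algebroid_bracket_def vector_field_bracket_def)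

lemma algebroid_bracket_add_right:
  assumes \<sigma>: "algebroid_section oct_groupoid \<sigma>" and \<tau>: "algebroid_section oct_groupoid \<tau>"
    and \<tau>': "algebroid_section oct_groupoid \<tau>'"
  shows "algebroid_bracket oct_groupoid \<sigma> (\<lambda>q. \<tau> q + \<tau>' q) p =
    algebroid_bracket oct_groupoid \<sigma> \<tau> p + algebroid_bracket oct_groupoid \<sigma> \<tau>' p"
proof -
  note \<sigma>D = algebroid_section_oct_groupoidD[OF \<sigma>] and \<tau>D = algebroid_section_oct_groupoidD[OF \<tau>]
    and \<tau>'D = algebroid_section_oct_groupoidD[OF \<tau>']
  have range: "range (\<lambda>q. \<tau> q + \<tau>' q) \<subseteq> range E0_incl"
    using \<tau>D(1) \<tau>'D(1) by (intro image_subsetI subspace_add[OF subspace_range_E0_incl]) auto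
  have lin: "linear (oct_dtarget p)" "linear (oct_dlambda p)"
    "linear (frechet_derivative \<sigma> (at p))"
    using oct_target_has_derivative oct_lambda_has_derivative \<sigma>D(2)
    by (blast intro: has_derivative_linear)+
  show ?thesis
    unfolding algebroid_bracket_oct_groupoid[OF \<sigma>D \<tau>D]
      algebroid_bracket_oct_groupoid[OF \<sigma>D \<tau>'D]
      algebroid_bracket_oct_groupoid[OF \<sigma>D range has_derivative_add[OF \<tau>D(2) \<tau>'D(2)]]
    by (simp add: lin[THEN linear_add] algebra_simps)
qed

text \<open>Differentiating \<open>f\<close> along \<open>oct_dtarget p (\<sigma> p)\<close>
  produces the extra term, and that vector is the anchor of \<open>\<sigma> p\<close>. In all other
  terms \<open>f p\<close> comes out by linearity, also from the derivative of
  \<open>\<sigma>\<close>.\<close>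

lemma algebroid_bracket_leibniz:
  fixes f :: "octonion \<times> octonion \<Rightarrow> real"
  assumes \<sigma>: "algebroid_section oct_groupoid \<sigma>" and \<tau>: "algebroid_section oct_groupoid \<tau>"
    and f: "f differentiable (at p)"
  shows "algebroid_bracket oct_groupoid \<sigma> (\<lambda>q. f q *\<^sub>R \<tau> q) p =
    f p *\<^sub>R algebroid_bracket oct_groupoid \<sigma> \<tau> p +
    frechet_derivative f (at p) (algebroid_anchor oct_groupoid p (\<sigma> p)) *\<^sub>R \<tau> p"
proof -
  note \<sigma>D = algebroid_section_oct_groupoidD[OF \<sigma>] and \<tau>D = algebroid_section_oct_groupoidD[OF \<tau>]
  have range: "range (\<lambda>q. f q *\<^sub>R \<tau> q) \<subseteq> range E0_incl"
    using \<tau>D(1) by (intro image_subsetI subspace_scale[OF subspace_range_E0_incl]) auto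
  have lin: "linear (oct_dtarget p)" "linear (oct_dlambda p)"
    "linear (frechet_derivative \<sigma> (at p))"
    using oct_target_has_derivative oct_lambda_has_derivative \<sigma>D(2)
    by (blast intro: has_derivative_linear)+
  have fD: "(f has_derivative frechet_derivative f (at p)) (at p)"
    using f by (simp add: frechet_derivative_works)
  show ?thesis
    unfolding algebroid_bracket_oct_groupoid[OF \<sigma>D \<tau>D] algebroid_anchor_oct_groupoid
      algebroid_bracket_oct_groupoid[OF \<sigma>D range has_derivative_scaleR[OF fD \<tau>D(2)]]
    by (simp add: lin[THEN linear_scale] algebra_simps)
qed

section \<open>The trivialization and the constant sections\<close>

lemma linear_E0_incl: "linear E0_incl"
  by (rule linearI) (auto simp: E0_incl_eq)

lemma inj_E0_incl: "inj E0_incl"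
  by (auto simp: inj_def E0_incl_eq prod_eq_iff)

text \<open>Constant sections have derivative 0, which leaves only the two terms from the
  differential of \<open>oct_lambda\<close>.\<close>

lemma algebroid_bracket_const:
  "algebroid_bracket oct_groupoid (\<lambda>_. E0_incl w) (\<lambda>_. E0_incl w') p =
     E0_incl ((fst p \<bullet> fst w + snd p \<bullet> snd w) *\<^sub>R w' - (fst p \<bullet> fst w' + snd p \<bullet> snd w') *\<^sub>R w)"
proof -
  have "range (\<lambda>_. E0_incl w) \<subseteq> range E0_incl" for w by auto
  from algebroid_bracket_oct_groupoid[OF this has_derivative_const this has_derivative_const]
  show ?thesis
    by (simp add: E0_incl_eq oct_dlambda_def)
qed

text \<open>Every section is a combination of constant ones with smooth coefficients, so
  skew-symmetry, additivity and the Leibniz rule extend the formula for constant sections to all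
  sections.\<close>

theorem proposition3p12:
  shows
    "(linear E0_incl \<and> (\<forall>p. bij_betw E0_incl UNIV (algebroid_fibre oct_groupoid p))) \<and>
     (\<forall>x y u v.
        algebroid_anchor oct_groupoid (x, y) (E0_incl (u, v)) =
          ((norm x)\<^sup>2 *\<^sub>R u + (x \<odot> oct_cnj y) \<odot> v - (x \<bullet> u + y \<bullet> v) *\<^sub>R x,
           (norm y)\<^sup>2 *\<^sub>R v + (y \<odot> oct_cnj x) \<odot> u - (x \<bullet> u + y \<bullet> v) *\<^sub>R y)) \<and>
     (\<forall>u v u' v' x y.
        algebroid_bracket oct_groupoid (\<lambda>_. E0_incl (u, v)) (\<lambda>_. E0_incl (u', v')) (x, y) =
          E0_incl ((x \<bullet> u + y \<bullet> v) *\<^sub>R (u', v') - (x \<bullet> u' + y \<bullet> v') *\<^sub>R (u, v))) \<and>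
     (\<forall>\<sigma> \<tau> \<tau>' (f :: octonion \<times> octonion \<Rightarrow> real) p.
        algebroid_section oct_groupoid \<sigma> \<longrightarrow> algebroid_section oct_groupoid \<tau> \<longrightarrow>
        algebroid_section oct_groupoid \<tau>' \<longrightarrow> smooth_on UNIV f \<longrightarrow>
          algebroid_bracket oct_groupoid \<sigma> \<tau> p \<in> algebroid_fibre oct_groupoid p \<and>
          algebroid_bracket oct_groupoid \<sigma> \<tau> p = - algebroid_bracket oct_groupoid \<tau> \<sigma> p \<and>
          algebroid_bracket oct_groupoid \<sigma> (\<lambda>q. \<tau> q + \<tau>' q) p =
            algebroid_bracket oct_groupoid \<sigma> \<tau> p + algebroid_bracket oct_groupoid \<sigma> \<tau>' p \<and>
          algebroid_bracket oct_groupoid \<sigma> (\<lambda>q. f q *\<^sub>R \<tau> q) p =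
            f p *\<^sub>R algebroid_bracket oct_groupoid \<sigma> \<tau> p +
            frechet_derivative f (at p) (algebroid_anchor oct_groupoid p (\<sigma> p)) *\<^sub>R \<tau> p)"
proof (intro conjI allI impI)
  show "linear E0_incl" by (rule linear_E0_incl)
  show "bij_betw E0_incl UNIV (algebroid_fibre oct_groupoid p)" for p
    by (simp add: algebroid_fibre_oct_groupoid bij_betw_def inj_E0_incl)
  show "algebroid_anchor oct_groupoid (x, y) (E0_incl (u, v)) =
      ((norm x)\<^sup>2 *\<^sub>R u + (x \<odot> oct_cnj y) \<odot> v - (x \<bullet> u + y \<bullet> v) *\<^sub>R x,
       (norm y)\<^sup>2 *\<^sub>R v + (y \<odot> oct_cnj x) \<odot> u - (x \<bullet> u + y \<bullet> v) *\<^sub>R y)" for x y u v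
    by (simp add: algebroid_anchor_oct_groupoid oct_dtarget_def oct_dlambda_def
        power2_norm_eq_inner)
  show "algebroid_bracket oct_groupoid (\<lambda>_. E0_incl (u, v)) (\<lambda>_. E0_incl (u', v')) (x, y) =
      E0_incl ((x \<bullet> u + y \<bullet> v) *\<^sub>R (u', v') - (x \<bullet> u' + y \<bullet> v') *\<^sub>R (u, v))" for u v u' v' x y
    using algebroid_bracket_const[of "(u, v)" "(u', v')" "(x, y)"] by simp
next
  fix \<sigma> \<tau> \<tau>' and f :: "octonion \<times> octonion \<Rightarrow> real" and p
  assume \<sigma>: "algebroid_section oct_groupoid \<sigma>" and \<tau>: "algebroid_section oct_groupoid \<tau>"
    and \<tau>': "algebroid_section oct_groupoid \<tau>'" and f: "smooth_on UNIV f"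
  show "algebroid_bracket oct_groupoid \<sigma> \<tau> p \<in> algebroid_fibre oct_groupoid p"
    by (rule algebroid_bracket_in_fibre[OF \<sigma> \<tau>])
  show "algebroid_bracket oct_groupoid \<sigma> \<tau> p = - algebroid_bracket oct_groupoid \<tau> \<sigma> p"
    by (rule algebroid_bracket_skew)
  show "algebroid_bracket oct_groupoid \<sigma> (\<lambda>q. \<tau> q + \<tau>' q) p =
      algebroid_bracket oct_groupoid \<sigma> \<tau> p + algebroid_bracket oct_groupoid \<sigma> \<tau>' p"
    by (rule algebroid_bracket_add_right[OF \<sigma> \<tau> \<tau>'])
  show "algebroid_bracket oct_groupoid \<sigma> (\<lambda>q. f q *\<^sub>R \<tau> q) p =
      f p *\<^sub>R algebroid_bracket oct_groupoid \<sigma> \<tau> p +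
      frechet_derivative f (at p) (algebroid_anchor oct_groupoid p (\<sigma> p)) *\<^sub>R \<tau> p"
    by (rule algebroid_bracket_leibniz[OF \<sigma> \<tau> smooth_on_differentiable[OF f UNIV_I]])
qed

end
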